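(* Let $\mathcal{G}$ and $\mathcal{H}$ be two sets of graphs, let $W_{\mathcal{G}}$ and $W_{\mathcal{H}}$ be the corresponding graphons, and let $\mathcal{F}_{\mathcal{G}}$ and $\mathcal{F}_{\mathcal{H}}$ be the corresponding sets of discriminative motifs (each motif being a finite simple graph). Let $\lambda\in[0,1]$ and let $W_{\mathcal{I}}=\lambda W_{\mathcal{G}}+(1-\lambda)W_{\mathcal{H}}$ be the mixed graphon. Then for every $F_{\mathcal{G}}\in\mathcal{F}_{\mathcal{G}}$ and every $F_{\mathcal{H}}\in\mathcal{F}_{\mathcal{H}}$, $$\left|t(F_{\mathcal{G}},W_{\mathcal{I}})-t(F_{\mathcal{G}},W_{\mathcal{G}})\right|\le (1-\lambda)\,\mathrm{e}(F_{\mathcal{G}})\,\|W_{\mathcal{H}}-W_{\mathcal{G}}\|_{\square},$$ $$\left|t(F_{\mathcal{H}},W_{\mathcal{I}})-t(F_{\mathcal{H}},W_{\mathcal{H}})\right|\le \lambda\,\mathrm{e}(F_{\mathcal{H}})\,\|W_{\mathcal{H}}-W_{\mathcal{G}}\|_{\square}.$$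
   Context: Graphs are finite, simple and undirected; $V(F)$ and $E(F)$ are the node set and edge set of a graph $F$, and $\mathrm{e}(F)=|E(F)|$ is its number of edges. A graphon is a continuous, bounded, symmetric function $W:[0,1]^2\to[0,1]$. Each set of graphs $\mathcal{G}$ (the graphs of one class) has an associated graphon $W_{\mathcal{G}}$, regarded as the generator of the graphs in that set. Discriminative motifs: a discriminative motif $F_G$ of a graph $G$ is the subgraph of $G$, with the minimal number of nodes and edges, that can decide the class of $G$; $\mathcal{F}_{\mathcal{G}}$ is the set of discriminative motifs for graphs in the set $\mathcal{G}$. It is assumed that every graph has a discriminative motif and that $\mathcal{F}_{\mathcal{G}}$ is finite for a set of graphs $\mathcal{G}$. The homomorphism density of a graph $F$ in a graphon $W$ is $$t(F,W)=\int_{[0,1]^{V(F)}}\prod_{\{i,j\}\in E(F)}W(x_i,x_j)\prod_{i\in V(F)}dx_i .$$ The cut norm of a bounded measurable function $U:[0,1]^2\to\mathbb{R}$ (here $U=W_{\mathcal{H}}-W_{\mathcal{G}}$) is $$\|U\|_{\square}=\sup_{S,T\subseteq[0,1]}\left|\int_{S\times T}U(x,y)\,dx\,dy\right|,$$ where the supremum is over all measurable subsets $S,T$ of $[0,1]$. *)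

theory Defs
  imports "HOL-Analysis.Analysis"
begin

datatype 'a graph = Graph (nodes: "'a set") (edges: "'a set set")

definition simple_graph :: "'a graph \<Rightarrow> bool" where
  "simple_graph G \<longleftrightarrow> finite (nodes G) \<and> (\<forall>e\<in>edges G. e \<subseteq> nodes G \<and> card e = 2)"

abbreviation num_edges :: "'a graph \<Rightarrow> nat" where
  "num_edges G \<equiv> card (edges G)"

definition subgraph :: "'a graph \<Rightarrow> 'a graph \<Rightarrow> bool" where
  "subgraph F G \<longleftrightarrow> simple_graph F \<and> nodes F \<subseteq> nodes G \<and> edges F \<subseteq> edges G"

definition graph_iso :: "'a graph \<Rightarrow> 'a graph \<Rightarrow> bool" where
  "graph_iso F G \<longleftrightarrow>
     (\<exists>f. bij_betw f (nodes F) (nodes G) \<and> edges G = (\<lambda>e. f ` e) ` edges F)"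

definition finite_up_to_iso :: "'a graph set \<Rightarrow> bool" where
  "finite_up_to_iso \<F> \<longleftrightarrow> (\<exists>R. finite R \<and> (\<forall>F\<in>\<F>. \<exists>F'\<in>R. graph_iso F F'))"

text \<open>
  A class of graphs is identified with the set of its members. What it means that a subgraph
  ``can decide the class'' of a graph is left open in the source, so it is a parameter here:
  \<open>decides F G C\<close> says that \<open>F\<close> can decide that the class of \<open>G\<close> is \<open>C\<close>.

  ``Minimal number of nodes and edges'' is minimality of the pair (number of nodes, number of
  edges) in the product order. This is the most inclusive reading: subgraphs minimising both
  numbers at once, or minimising them lexicographically, are motifs in this sense too.
\<close>

definition deciding_subgraph ::
    "('a graph \<Rightarrow> 'a graph \<Rightarrow> 'a graph set \<Rightarrow> bool) \<Rightarrow> 'a graph set \<Rightarrow> 'a graph \<Rightarrow> 'a graph \<Rightarrow> bool"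
  where
  "deciding_subgraph decides C G F \<longleftrightarrow> subgraph F G \<and> decides F G C"

definition discriminative_motif ::
    "('a graph \<Rightarrow> 'a graph \<Rightarrow> 'a graph set \<Rightarrow> bool) \<Rightarrow> 'a graph set \<Rightarrow> 'a graph \<Rightarrow> 'a graph \<Rightarrow> bool"
  where
  "discriminative_motif decides C G F \<longleftrightarrow>
     deciding_subgraph decides C G F \<and>
     (\<forall>F'. deciding_subgraph decides C G F' \<longrightarrow>
        card (nodes F') \<le> card (nodes F) \<longrightarrow> num_edges F' \<le> num_edges F \<longrightarrow>
        card (nodes F') = card (nodes F) \<and> num_edges F' = num_edges F)"

definition discriminative_motifs ::
    "('a graph \<Rightarrow> 'a graph \<Rightarrow> 'a graph set \<Rightarrow> bool) \<Rightarrow> 'a graph set \<Rightarrow> 'a graph set"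
  where
  "discriminative_motifs decides C = {F. \<exists>G\<in>C. discriminative_motif decides C G F}"

text \<open>
  Only the values on the unit square matter; boundedness is part of the range condition.
\<close>

definition graphon :: "(real \<Rightarrow> real \<Rightarrow> real) \<Rightarrow> bool" where
  "graphon W \<longleftrightarrow>
     continuous_on ({0..1} \<times> {0..1}) (\<lambda>(x, y). W x y) \<and>
     (\<forall>x\<in>{0..1}. \<forall>y\<in>{0..1}. W x y = W y x \<and> 0 \<le> W x y \<and> W x y \<le> 1)"

definition mix_graphon ::
    "real \<Rightarrow> (real \<Rightarrow> real \<Rightarrow> real) \<Rightarrow> (real \<Rightarrow> real \<Rightarrow> real) \<Rightarrow> real \<Rightarrow> real \<Rightarrow> real" where
  "mix_graphon l W W' = (\<lambda>x y. l * W x y + (1 - l) * W' x y)"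

text \<open>
  The factor \<open>W (x i) (x j)\<close> of an unordered edge \<open>{i, j}\<close>. The order in which the endpoints
  are taken is chosen arbitrarily; it does not matter because graphons are symmetric.
\<close>

definition edge_weight :: "(real \<Rightarrow> real \<Rightarrow> real) \<Rightarrow> ('a \<Rightarrow> real) \<Rightarrow> 'a set \<Rightarrow> real" where
  "edge_weight W x e = (let p = (SOME p. e = {fst p, snd p}) in W (x (fst p)) (x (snd p)))"

lemma edge_weight_eq:
  assumes "graphon W" "x i \<in> {0..1}" "x j \<in> {0..1}"
  shows "edge_weight W x {i, j} = W (x i) (x j)"
proof -
  define p where "p = (SOME p. {i, j} = {fst p, snd p})"
  have "{i, j} = {fst p, snd p}"
    unfolding p_def by (rule someI[of _ "(i, j)"]) simp
  then have "fst p = i \<and> snd p = j \<or> fst p = j \<and> snd p = i"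
    by (auto simp: doubleton_eq_iff)
  then show ?thesis
    using assms unfolding edge_weight_def graphon_def Let_def p_def[symmetric] by auto
qed

definition hom_density :: "'a graph \<Rightarrow> (real \<Rightarrow> real \<Rightarrow> real) \<Rightarrow> real" where
  "hom_density F W =
     (LINT x | (\<Pi>\<^sub>M i\<in>nodes F. restrict_space lborel {0..1}).
        (\<Prod>e\<in>edges F. edge_weight W x e))"

text \<open>The supremum is meaningful for bounded measurable \<open>U\<close> only.\<close>

definition cut_norm :: "(real \<Rightarrow> real \<Rightarrow> real) \<Rightarrow> real" where
  "cut_norm U =
     (SUP (S, T) \<in> {S \<in> sets lebesgue. S \<subseteq> {0..1}} \<times> {T \<in> sets lebesgue. T \<subseteq> {0..1}}.
        \<bar>LINT (x, y) : S \<times> T | lebesgue. U x y\<bar>)"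

end

theory Submission
  imports Defs "HOL-Probability.Infinite_Product_Measure"
begin

text \<open>
  Replacing the edge factors of one graphon by those of another one edge at a time changes the
  density by a sum of \<open>e(F)\<close> integrals, each containing the factor \<open>(W - W')(x\<^sub>u, x\<^sub>v)\<close> exactly once.
  When all coordinates other than \<open>x\<^sub>u\<close> and \<open>x\<^sub>v\<close> are fixed, the remaining factors split into a
  function of \<open>x\<^sub>u\<close> and a function of \<open>x\<^sub>v\<close> with values in \<open>[0, 1]\<close>, because \<open>F\<close> has no multiple
  edges; a bilinear integral with such weights is at most the cut norm of \<open>W - W'\<close>. For the mixed
  graphon, \<open>W - W'\<close> is a scalar multiple of \<open>W\<^sub>H - W\<^sub>G\<close>.
\<close>

section \<open>The unit interval as a probability space, and kernels on the square\<close>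

definition unit_lborel :: "real measure" where
  "unit_lborel = restrict_space lborel {0..1}"

lemma space_unit_lborel [simp]: "space unit_lborel = {0..1}"
  by (simp add: unit_lborel_def)

lemma sets_unit_lborel: "S \<in> sets unit_lborel \<longleftrightarrow> S \<in> sets borel \<and> S \<subseteq> {0..1}"
  by (auto simp: unit_lborel_def sets_restrict_space_iff)

lemma prob_space_unit_lborel: "prob_space unit_lborel"
  by (auto intro!: prob_spaceI simp: unit_lborel_def emeasure_restrict_space space_restrict_space)

interpretation unit_lborel: prob_space unit_lborel
  by (rule prob_space_unit_lborel)

lemma measure_unit_lborel [simp]: "measure unit_lborel {0..1} = 1"
  using unit_lborel.prob_space by simp

interpretation unit_lborel_pair: pair_prob_space unit_lborel unit_lborel ..

text \<open>A class that contains graphons and their differences and is closed under negation. Borel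
  measurability on the square is enough for all integrals below, and the bound 1 is the one
  satisfied by a difference of two functions with values in [0, 1].\<close>

definition unit_kernel :: "(real \<Rightarrow> real \<Rightarrow> real) \<Rightarrow> bool" where
  "unit_kernel U \<longleftrightarrow>
     (\<lambda>(x, y). U x y) \<in> borel_measurable (restrict_space borel ({0..1} \<times> {0..1})) \<and>
     (\<forall>x\<in>{0..1}. \<forall>y\<in>{0..1}. \<bar>U x y\<bar> \<le> 1)"

lemma unit_kernel_bound: "unit_kernel U \<Longrightarrow> x \<in> {0..1} \<Longrightarrow> y \<in> {0..1} \<Longrightarrow> \<bar>U x y\<bar> \<le> 1"
  by (simp add: unit_kernel_def)

lemma unit_kernel_uminus: "unit_kernel U \<Longrightarrow> unit_kernel (\<lambda>x y. - U x y)"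
  by (simp add: unit_kernel_def case_prod_beta')

text \<open>The Borel sigma-algebra of the square has to be compared with the product of two
  restricted ones; the identity map is measurable from the latter to the former.\<close>

lemma unit_kernel_measurable:
  assumes "unit_kernel U"
  shows "(\<lambda>(x, y). U x y) \<in> borel_measurable (unit_lborel \<Otimes>\<^sub>M unit_lborel)"
proof -
  have id: "(\<lambda>x. x) \<in> unit_lborel \<rightarrow>\<^sub>M borel"
    by (simp add: unit_lborel_def measurable_restrict_space1)
  have "(\<lambda>p. (fst p, snd p)) \<in> unit_lborel \<Otimes>\<^sub>M unit_lborel \<rightarrow>\<^sub>M borel \<Otimes>\<^sub>M borel"
    by (rule measurable_Pair[OF measurable_compose[OF measurable_fst id]
          measurable_compose[OF measurable_snd id]])
  then have "(\<lambda>p. p) \<in> unit_lborel \<Otimes>\<^sub>M unit_lborel \<rightarrow>\<^sub>M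
      restrict_space borel ({0..1} \<times> {0..1})"
    unfolding borel_prod prod.collapse
    by (rule measurable_restrict_space2[rotated]) (simp add: space_pair_measure)
  moreover have "(\<lambda>(x, y). U x y) \<in> borel_measurable (restrict_space borel ({0..1} \<times> {0..1}))"
    using assms by (simp add: unit_kernel_def)
  ultimately show ?thesis
    by (rule measurable_compose)
qed

section \<open>Integrals over rectangles and the cut norm\<close>

text \<open>Links the two-dimensional Lebesgue integral in \<open>cut_norm\<close> with the iterated
  integrals that arise when coordinates are integrated out one by one. Borel sets \<open>S\<close>
  and \<open>T\<close> suffice, since the sets inserted later are level sets of Borel
  functions.\<close>

lemma cut_integral_eq:
  assumes U: "unit_kernel U" and S: "S \<in> sets unit_lborel" and T: "T \<in> sets unit_lborel"
  shows "(LINT (x, y) : S \<times> T | lebesgue. U x y) =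
    (LINT x|unit_lborel. LINT y|unit_lborel. indicator S x * (indicator T y * U x y))"
proof -
  define V where "V = (\<lambda>p. indicator (S \<times> T) p * (case p of (x, y) \<Rightarrow> U x y))"
  have ST: "S \<in> sets borel" "T \<in> sets borel" "S \<subseteq> {0..1}" "T \<subseteq> {0..1}"
    using S T by (auto simp: sets_unit_lborel)
  have sq: "{0..1} \<times> {0..1} \<in> sets (borel :: (real \<times> real) measure)"
    by (intro borel_closed closed_Times) auto
  have "S \<times> T \<in> sets borel"
    unfolding borel_prod[symmetric] using ST by auto
  \<comment> \<open>\<open>U\<close> is known to be measurable only on the square. Cutting it off
    there gives a Borel function on the plane, and the cut-off is invisible in \<open>V\<close>
    because \<open>S \<times> T\<close> lies inside the square.\<close>
  moreover have "(\<lambda>p. indicator ({0..1} \<times> {0..1}) p *\<^sub>R (case p of (x, y) \<Rightarrow> U x y))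
      \<in> borel_measurable borel"
    using U sq by (simp add: unit_kernel_def borel_measurable_restrict_space_iff)
  ultimately have "(\<lambda>p. indicator (S \<times> T) p *
      (indicator ({0..1} \<times> {0..1}) p *\<^sub>R (case p of (x, y) \<Rightarrow> U x y))) \<in> borel_measurable borel"
    by (intro borel_measurable_times borel_measurable_indicator)
  also have "(\<lambda>p. indicator (S \<times> T) p *
      (indicator ({0..1} \<times> {0..1}) p *\<^sub>R (case p of (x, y) \<Rightarrow> U x y))) = V"
    using ST by (auto simp: V_def indicator_def fun_eq_iff)
  finally have meas: "V \<in> borel_measurable borel" .
  have "integrable lborel (indicator ({0..1} \<times> {0..1}) :: real \<times> real \<Rightarrow> real)"
    using sq emeasure_bounded_finite[OF bounded_Times[OF bounded_closed_interval[of "0::real" 1] bounded_closed_interval[of "0::real" 1]]]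
    by (auto intro!: integrable_real_indicator simp: less_top[symmetric])
  moreover have "norm (V p) \<le> norm (indicator ({0..1} \<times> {0..1}) p :: real)" for p
    using ST unit_kernel_bound[OF U] by (auto simp: V_def indicator_def split: prod.splits)
  ultimately have int: "integrable lborel V"
    using meas by (intro Bochner_Integration.integrable_bound[of lborel _ V]) auto
  have "(LINT (x, y) : S \<times> T | lebesgue. U x y) = integral\<^sup>L lebesgue V"
    by (simp add: V_def set_lebesgue_integral_def)
  \<comment> \<open>\<open>V\<close> is Borel, so passing to the completion of the measure does not
    change its integral.\<close>
  also have "\<dots> = integral\<^sup>L lborel V"
    using meas by (simp add: integral_completion)
  also have "\<dots> = (LINT x|lborel. LINT y|lborel. V (x, y))"
    using lborel_pair.integral_fst'[of V] int by (simp add: lborel_prod)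
  \<comment> \<open>The extra indicators of [0, 1] turn both integrals into integrals over the
    restricted measure.\<close>
  also have "\<dots> = (LINT x|lborel. indicator {0..1} x *\<^sub>R (LINT y|lborel. indicator {0..1} y *\<^sub>R
      (indicator S x * (indicator T y * U x y))))"
    using ST(3,4)
    by (intro Bochner_Integration.integral_cong refl)
      (auto simp: V_def indicator_def intro!: Bochner_Integration.integral_cong)
  also have "\<dots> = (LINT x|unit_lborel. LINT y|unit_lborel. indicator S x * (indicator T y * U x y))"
    by (simp add: unit_lborel_def integral_restrict_space mult.left_commute)
  finally show ?thesis .
qed

text \<open>A real supremum dominates its members only when they are bounded above; here the area of
  the unit square is a bound.\<close>

lemma bdd_above_cut_norm:
  assumes U: "unit_kernel U"
  shows "bdd_above ((\<lambda>(S, T). \<bar>LINT (x, y) : S \<times> T | lebesgue. U x y\<bar>) `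
    ({S \<in> sets lebesgue. S \<subseteq> {0..1}} \<times> {T \<in> sets lebesgue. T \<subseteq> {0..1}}))"
proof (rule bdd_aboveI2)
  have sq: "{0..1::real} \<times> {0..1::real} \<in> lmeasurable"
    by (intro lmeasurable_compact compact_Times compact_Icc)
  fix p :: "real set \<times> real set"
  assume p: "p \<in> {S \<in> sets lebesgue. S \<subseteq> {0..1}} \<times> {T \<in> sets lebesgue. T \<subseteq> {0..1}}"
  obtain S T where ST: "p = (S, T)" "S \<subseteq> {0..1}" "T \<subseteq> {0..1}"
    using p by auto
  have "\<bar>LINT (x, y) : S \<times> T | lebesgue. U x y\<bar>
      \<le> (LINT p|lebesgue. indicator ({0..1} \<times> {0..1}) (p :: real \<times> real))"
    unfolding set_lebesgue_integral_def real_norm_def[symmetric]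
  \<comment> \<open>Both rules ask for integrability of the majorant only, so arbitrary Lebesgue
    sets \<open>S\<close> and \<open>T\<close> cause no difficulty.\<close>
  proof (rule order_trans[OF integral_norm_bound integral_mono'])
    show "integrable lebesgue (indicator ({0..1} \<times> {0..1}) :: real \<times> real \<Rightarrow> real)"
      using sq by (intro integrable_real_indicator) (auto simp: fmeasurable_def less_top)
    show "norm (indicator (S \<times> T) p *\<^sub>R (case p of (x, y) \<Rightarrow> U x y)) \<le>
      indicator ({0..1} \<times> {0..1}) p" for p
      using ST unit_kernel_bound[OF U, of "fst p" "snd p"]
      by (cases p) (auto simp: indicator_def)
  qed (simp add: indicator_def)
  then show "(case p of (S, T) \<Rightarrow> \<bar>LINT (x, y) : S \<times> T | lebesgue. U x y\<bar>)
      \<le> (LINT p|lebesgue. indicator ({0..1} \<times> {0..1}) (p :: real \<times> real))"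
    by (simp add: ST)
qed

lemma cut_norm_upper:
  assumes "unit_kernel U" "S \<in> sets lebesgue" "S \<subseteq> {0..1}" "T \<in> sets lebesgue" "T \<subseteq> {0..1}"
  shows "\<bar>LINT (x, y) : S \<times> T | lebesgue. U x y\<bar> \<le> cut_norm U"
  unfolding cut_norm_def using assms
  by (intro cSUP_upper2[OF bdd_above_cut_norm, of _ "(S, T)"]) auto

text \<open>Each rectangle integral scales by \<open>c\<close>, so each absolute value is
  \<open>\<bar>c\<bar>\<close> times one that the supremum for \<open>U\<close> dominates.\<close>

lemma cut_norm_cmult_le:
  assumes "unit_kernel U"
  shows "cut_norm (\<lambda>x y. c * U x y) \<le> \<bar>c\<bar> * cut_norm U"
  unfolding cut_norm_def[of "\<lambda>x y. c * U x y"]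
proof (rule cSUP_least; clarify)
  fix S T :: "real set"
  assume *: "S \<in> sets lebesgue" "S \<subseteq> {0..1}" "T \<in> sets lebesgue" "T \<subseteq> {0..1}"
  have "(LINT (x, y) : S \<times> T | lebesgue. c * U x y) = c * (LINT (x, y) : S \<times> T | lebesgue. U x y)"
    using set_integral_mult_right[of lebesgue "S \<times> T" c "\<lambda>(x, y). U x y"]
    by (simp add: case_prod_beta')
  then show "\<bar>LINT (x, y) : S \<times> T | lebesgue. c * U x y\<bar> \<le> \<bar>c\<bar> * cut_norm U"
    using cut_norm_upper[OF assms *] by (simp add: abs_mult mult_left_mono)
qed auto

lemma cut_norm_uminus_le:
  assumes "unit_kernel U"
  shows "cut_norm (\<lambda>x y. - U x y) \<le> cut_norm U"
  using cut_norm_cmult_le[OF assms, of "-1"] by simp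

section \<open>Bilinear integrals with weights in [0, 1]\<close>

text \<open>The integral is largest when the weight is the indicator of the set where \<open>A\<close> is positive.\<close>

lemma (in prob_space) integral_weight_le_level_set:
  assumes f: "f \<in> borel_measurable M" "\<And>x. x \<in> space M \<Longrightarrow> 0 \<le> f x \<and> f x \<le> 1"
    and A: "integrable M A"
  shows "\<exists>S\<in>sets M. (LINT x|M. f x * A x) \<le> (LINT x|M. indicator S x * A x :: real)"
proof -
  have [measurable]: "f \<in> borel_measurable M" "A \<in> borel_measurable M" using f A by auto
  define S where "S = {x \<in> space M. 0 < A x}"
  have S[measurable]: "S \<in> sets M" unfolding S_def by measurable
  have "(LINT x|M. f x * A x) \<le> (LINT x|M. indicator S x * A x)"
  proof (rule integral_mono)
    show "integrable M (\<lambda>x. f x * A x)"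
      by (rule Bochner_Integration.integrable_bound[OF A])
        (use f(2) in \<open>simp_all add: abs_mult mult_left_le_one_le\<close>)
    show "integrable M (\<lambda>x. indicator S x * A x)"
      using integrable_mult_indicator[OF S A] by simp
    show "f x * A x \<le> indicator S x * A x" if "x \<in> space M" for x
      using f(2)[OF that] that
      by (cases "0 < A x") (simp_all add: S_def mult_left_le_one_le mult_nonneg_nonpos)
  qed
  with S show ?thesis by blast
qed

text \<open>The integral is linear in each weight separately, so it does not decrease when first
  \<open>f\<close> and then \<open>g\<close> is replaced by the indicator of a suitable level set.
  With two indicators it is an integral over a rectangle.\<close>

lemma bilinear_le_cut_norm:
  assumes U: "unit_kernel U"
    and f: "f \<in> borel_measurable unit_lborel" "\<And>x. x \<in> {0..1} \<Longrightarrow> 0 \<le> f x \<and> f x \<le> 1"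
    and g: "g \<in> borel_measurable unit_lborel" "\<And>x. x \<in> {0..1} \<Longrightarrow> 0 \<le> g x \<and> g x \<le> 1"
  shows "(LINT x|unit_lborel. LINT y|unit_lborel. f x * (g y * U x y)) \<le> cut_norm U"
proof -
  note [measurable] = f(1) g(1) unit_kernel_measurable[OF U]
  have bd: "\<bar>a * (b * U x y)\<bar> \<le> 1" if "x \<in> {0..1}" "y \<in> {0..1}" "0 \<le> a \<and> a \<le> 1" "0 \<le> b \<and> b \<le> 1"
    for a b x y
    using unit_kernel_bound[OF U that(1,2)] that(3,4) by (simp add: abs_mult mult_le_one)
  have ind: "0 \<le> (indicator S x :: real) \<and> (indicator S x :: real) \<le> 1" for S and x :: real
    by (simp add: indicator_def)
  have int: "integrable (unit_lborel \<Otimes>\<^sub>M unit_lborel) (\<lambda>(x, y). h x * (k y * U x y))"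
    if [measurable]: "h \<in> borel_measurable unit_lborel" "k \<in> borel_measurable unit_lborel"
      and "\<And>x. x \<in> {0..1} \<Longrightarrow> 0 \<le> h x \<and> h x \<le> 1" "\<And>x. x \<in> {0..1} \<Longrightarrow> 0 \<le> k x \<and> k x \<le> 1"
    for h k
    by (rule unit_lborel_pair.P.integrable_const_bound[where B = 1])
      (use bd that(3,4) in \<open>auto simp: space_pair_measure\<close>)
  have "integrable unit_lborel (\<lambda>x. LINT y|unit_lborel. g y * U x y)"
    using unit_lborel_pair.integrable_fst[OF int[of "\<lambda>_. 1" g]] g by simp
  then have "\<exists>S\<in>sets unit_lborel. (LINT x|unit_lborel. f x * (LINT y|unit_lborel. g y * U x y))
      \<le> (LINT x|unit_lborel. indicator S x * (LINT y|unit_lborel. g y * U x y))"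
    using f by (intro unit_lborel.integral_weight_le_level_set) simp_all
  then obtain S where S[measurable]: "S \<in> sets unit_lborel"
    and 1: "(LINT x|unit_lborel. f x * (LINT y|unit_lborel. g y * U x y))
      \<le> (LINT x|unit_lborel. indicator S x * (LINT y|unit_lborel. g y * U x y))"
    by blast
  \<comment> \<open>Second round: \<open>S\<close> is now fixed and the integral over
    \<open>y\<close> is the outer one, so \<open>T\<close> may depend on \<open>S\<close>.\<close>
  have "integrable unit_lborel (\<lambda>y. LINT x|unit_lborel. indicator S x * U x y)"
    using unit_lborel_pair.integrable_snd[OF int[of "indicator S" "\<lambda>_. 1"]] ind by simp
  then have "\<exists>T\<in>sets unit_lborel.
      (LINT y|unit_lborel. g y * (LINT x|unit_lborel. indicator S x * U x y))
      \<le> (LINT y|unit_lborel. indicator T y * (LINT x|unit_lborel. indicator S x * U x y))"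
    using g by (intro unit_lborel.integral_weight_le_level_set) simp_all
  then obtain T where T[measurable]: "T \<in> sets unit_lborel"
    and 2: "(LINT y|unit_lborel. g y * (LINT x|unit_lborel. indicator S x * U x y))
      \<le> (LINT y|unit_lborel. indicator T y * (LINT x|unit_lborel. indicator S x * U x y))"
    by blast
  \<comment> \<open>Fubini, used with \<open>k\<close> equal to \<open>g\<close> to pass from the
    first round to the second, and with \<open>k\<close> equal to the indicator of \<open>T\<close>
    to return.\<close>
  have swap: "(LINT x|unit_lborel. LINT y|unit_lborel. indicator S x * (k y * U x y)) =
      (LINT y|unit_lborel. k y * (LINT x|unit_lborel. indicator S x * U x y))"
    if "k \<in> borel_measurable unit_lborel" "\<And>x. x \<in> {0..1} \<Longrightarrow> 0 \<le> k x \<and> k x \<le> 1" for k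
    using unit_lborel_pair.Fubini_integral[OF int[of "indicator S" k]] that ind
    by (simp add: mult.left_commute)
  have "(LINT x|unit_lborel. LINT y|unit_lborel. f x * (g y * U x y))
      \<le> (LINT x|unit_lborel. LINT y|unit_lborel. indicator S x * (indicator T y * U x y))"
    using 1 2 swap[OF g] swap[of "indicator T"] ind by simp
  also have "\<dots> = (LINT (x, y) : S \<times> T | lebesgue. U x y)"
    using cut_integral_eq[OF U S T] by simp
  also have "\<dots> \<le> cut_norm U"
    using cut_norm_upper[OF U, of S T] S T by (auto simp: sets_unit_lborel)
  finally show ?thesis .
qed

text \<open>The level set argument bounds the integral from above only; the lower bound is the same
  argument for \<open>-U\<close>.\<close>

lemma abs_bilinear_le_cut_norm:
  assumes U: "unit_kernel U"
    and f: "f \<in> borel_measurable unit_lborel" "\<And>x. x \<in> {0..1} \<Longrightarrow> 0 \<le> f x \<and> f x \<le> 1"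
    and g: "g \<in> borel_measurable unit_lborel" "\<And>x. x \<in> {0..1} \<Longrightarrow> 0 \<le> g x \<and> g x \<le> 1"
  shows "\<bar>LINT x|unit_lborel. LINT y|unit_lborel. f x * (g y * U x y)\<bar> \<le> cut_norm U"
  using bilinear_le_cut_norm[OF assms] bilinear_le_cut_norm[OF unit_kernel_uminus[OF U] f g]
    cut_norm_uminus_le[OF U] by simp

lemma cut_norm_nonneg: "unit_kernel U \<Longrightarrow> 0 \<le> cut_norm U"
  using cut_norm_upper[of U "{}" "{}"] by simp

section \<open>Graphons as kernels, and their mixtures\<close>

lemma graphon_bounds:
  "graphon W \<Longrightarrow> x \<in> {0..1} \<Longrightarrow> y \<in> {0..1} \<Longrightarrow> 0 \<le> W x y \<and> W x y \<le> 1"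
  by (simp add: graphon_def)

lemma unit_kernel_diff:
  assumes "graphon W" "graphon W'"
  shows "unit_kernel (\<lambda>x y. W x y - W' x y)"
proof -
  have "continuous_on ({0..1} \<times> {0..1}) (\<lambda>(x, y). W x y - W' x y)"
    using assms unfolding graphon_def case_prod_beta' by (intro continuous_on_diff) auto
  moreover have "\<bar>W x y - W' x y\<bar> \<le> 1" if "x \<in> {0..1}" "y \<in> {0..1}" for x y
    using graphon_bounds[OF assms(1) that] graphon_bounds[OF assms(2) that] by linarith
  ultimately show ?thesis
    by (simp add: unit_kernel_def borel_measurable_continuous_on_restrict)
qed

lemma graphon_unit_kernel:
  assumes "graphon W"
  shows "unit_kernel W"
proof -
  \<comment> \<open>Subtracting the zero graphon makes this an instance of the result on
    differences.\<close>
  have "graphon (\<lambda>x y. 0)" by (simp add: graphon_def)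
  from unit_kernel_diff[OF assms this] show ?thesis by simp
qed

lemma graphon_mix_graphon:
  assumes "graphon W" "graphon W'" "0 \<le> l" "l \<le> 1"
  shows "graphon (mix_graphon l W W')"
proof -
  have "continuous_on ({0..1} \<times> {0..1}) (\<lambda>(x, y). mix_graphon l W W' x y)"
    using assms unfolding graphon_def mix_graphon_def case_prod_beta'
    by (intro continuous_intros) auto
  moreover have "l * W x y + (1 - l) * W' x y \<le> 1" if "x \<in> {0..1}" "y \<in> {0..1}" for x y
    using convex_bound_le[of "W x y" 1 "W' x y" l "1 - l"] assms(3,4)
      graphon_bounds[OF assms(1) that] graphon_bounds[OF assms(2) that] by simp
  ultimately show ?thesis
    using assms by (simp add: graphon_def mix_graphon_def)
qed

section \<open>The contribution of a single edge\<close>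

lemma prob_space_PiM_unit_lborel: "prob_space (\<Pi>\<^sub>M i\<in>V. unit_lborel)"
  by (rule prob_space_PiM) (rule prob_space_unit_lborel)

text \<open>
  \<open>P\<close> collects the factors of the edges avoiding \<open>v\<close>, \<open>Q\<close> those of the other edges, which avoid \<open>u\<close>.
\<close>

lemma abs_integral_edge_le_cut_norm:
  fixes U :: "real \<Rightarrow> real \<Rightarrow> real" and V :: "'a set"
  defines "N \<equiv> \<Pi>\<^sub>M i\<in>V. unit_lborel"
  assumes U: "unit_kernel U" and V: "finite V" "u \<in> V" "v \<in> V" "u \<noteq> v"
    and P: "P \<in> borel_measurable N" "\<And>x. x \<in> space N \<Longrightarrow> 0 \<le> P x \<and> P x \<le> 1"
      "\<And>x y. P (x(v := y)) = P x"
    and Q: "Q \<in> borel_measurable N" "\<And>x. x \<in> space N \<Longrightarrow> 0 \<le> Q x \<and> Q x \<le> 1"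
      "\<And>x y. Q (x(u := y)) = Q x"
  shows "\<bar>LINT x|N. P x * (Q x * U (x u) (x v))\<bar> \<le> cut_norm U"
proof -
  interpret product_sigma_finite "\<lambda>_. unit_lborel" ..
  interpret N: prob_space "\<Pi>\<^sub>M i\<in>J. unit_lborel" for J :: "'a set"
    by (rule prob_space_PiM_unit_lborel)
  define I where "I = V - {u, v}"
  have I: "finite I" "u \<notin> I" "v \<notin> insert u I" "V = insert v (insert u I)"
    using V by (auto simp: I_def)
  define F where "F x = P x * (Q x * U (x u) (x v))" for x
  have [measurable]: "(\<lambda>x. x u) \<in> N \<rightarrow>\<^sub>M unit_lborel" "(\<lambda>x. x v) \<in> N \<rightarrow>\<^sub>M unit_lborel"
    unfolding N_def using V by (auto intro!: measurable_component_singleton)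
  have "(\<lambda>x. U (x u) (x v)) \<in> borel_measurable N"
    using measurable_compose[of "\<lambda>x. (x u, x v)" N _ "\<lambda>(x, y). U x y"]
      unit_kernel_measurable[OF U] by simp
  then have meas_F: "F \<in> borel_measurable N"
    unfolding F_def using P(1) Q(1) by (intro borel_measurable_times)
  have bd_F: "\<bar>F x\<bar> \<le> 1" if "x \<in> space N" for x
  proof -
    have "x u \<in> {0..1}" "x v \<in> {0..1}"
      using that V by (auto simp: N_def space_PiM PiE_iff)
    then show ?thesis
      using unit_kernel_bound[OF U] P(2)[OF that] Q(2)[OF that]
      by (simp add: F_def abs_mult mult_le_one)
  qed
  have upd: "z(u := s, v := t) \<in> space N"
    if "z \<in> space (\<Pi>\<^sub>M i\<in>I. unit_lborel)" "s \<in> {0..1}" "t \<in> {0..1}" for z s t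
    using that unfolding N_def I(4) by (auto simp: space_PiM PiE_iff extensional_def)
  \<comment> \<open>\<open>V\<close> is decomposed as \<open>insert v (insert u I)\<close>, so
    \<open>v\<close> is integrated out first, giving \<open>G\<close>, and then \<open>u\<close>.
    What remains outside are the coordinates in \<open>I\<close>.\<close>
  define G where "G x = (LINT t|unit_lborel. F (x(v := t)))" for x
  have meas_upd: "(\<lambda>(x, t). F (x(v := t))) \<in>
      borel_measurable ((\<Pi>\<^sub>M i\<in>insert u I. unit_lborel) \<Otimes>\<^sub>M unit_lborel)"
    using measurable_compose[OF measurable_add_dim[of v "insert u I" "\<lambda>_. unit_lborel"], of F borel]
      meas_F unfolding N_def I(4) by (simp add: case_prod_beta')
  have meas_G: "G \<in> borel_measurable (\<Pi>\<^sub>M i\<in>insert u I. unit_lborel)"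
    unfolding G_def by (rule unit_lborel.borel_measurable_lebesgue_integral[OF meas_upd])
  have bd_G: "\<bar>G x\<bar> \<le> 1" if "x \<in> space (\<Pi>\<^sub>M i\<in>insert u I. unit_lborel)" for x
  proof -
    have "x(v := t) \<in> space N" if "t \<in> {0..1}" for t
      using that \<open>x \<in> _\<close> unfolding N_def I(4) by (auto simp: space_PiM PiE_iff extensional_def)
    then have "\<bar>G x\<bar> \<le> (LINT t|unit_lborel. 1)"
      unfolding G_def real_norm_def[symmetric]
      by (intro order_trans[OF integral_norm_bound integral_mono']) (simp_all add: bd_F)
    then show ?thesis by simp
  qed
  have "integrable N F"
    unfolding N_def using meas_F bd_F
    by (intro N.integrable_const_bound[where B = 1]) (simp_all add: N_def)
  then have "(LINT x|N. F x) = (LINT x|(\<Pi>\<^sub>M i\<in>insert u I. unit_lborel). G x)"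
    unfolding N_def I(4) G_def using I by (intro product_integral_insert) auto
  also have "\<dots> = (LINT z|(\<Pi>\<^sub>M i\<in>I. unit_lborel). LINT s|unit_lborel. G (z(u := s)))"
    using I meas_G bd_G
    by (intro product_integral_insert N.integrable_const_bound[where B = 1]) simp_all
  finally have eq: "(LINT x|N. F x) =
    (LINT z|(\<Pi>\<^sub>M i\<in>I. unit_lborel). LINT s|unit_lborel. LINT t|unit_lborel. F (z(u := s, v := t)))"
    by (simp add: G_def)
  have slice: "\<bar>LINT s|unit_lborel. LINT t|unit_lborel. F (z(u := s, v := t))\<bar> \<le> cut_norm U"
    if z: "z \<in> space (\<Pi>\<^sub>M i\<in>I. unit_lborel)" for z
  proof -
    \<comment> \<open>The value 0 is a placeholder for the coordinate on which the factor does not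
      depend; it is taken in [0, 1] so that the point stays in the space of \<open>N\<close>, where
      measurability and bounds are known.\<close>
    define p where "p s = P (z(u := s, v := 0))" for s
    define q where "q t = Q (z(u := 0, v := t))" for t
    have "(\<lambda>s. z(u := s, v := 0)) \<in> unit_lborel \<rightarrow>\<^sub>M N"
      unfolding N_def I(4) using z
      by (intro measurable_fun_upd[where J = "insert u I"] measurable_fun_upd[where J = I]) auto
    then have p: "p \<in> borel_measurable unit_lborel"
      unfolding p_def by (rule measurable_compose[OF _ P(1)])
    have "(\<lambda>t. z(u := 0, v := t)) \<in> unit_lborel \<rightarrow>\<^sub>M N"
      unfolding N_def I(4) using z
      by (intro measurable_fun_upd[where J = "insert u I"] measurable_fun_upd[where J = I]) auto
    then have q: "q \<in> borel_measurable unit_lborel"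
      unfolding q_def by (rule measurable_compose[OF _ Q(1)])
    \<comment> \<open>The update at \<open>u\<close> is the inner one, so it is first commuted past
      the update at \<open>v\<close>, which needs \<open>u \<noteq> v\<close>.\<close>
    have "Q (z(u := s, v := t)) = q t" for s t
      using Q(3)[of "z(v := t)" s] Q(3)[of "z(v := t)" 0] V(4) by (simp add: q_def fun_upd_twist)
    moreover have "P (z(u := s, v := t)) = p s" for s t
      by (simp add: p_def P(3))
    ultimately have "F (z(u := s, v := t)) = p s * (q t * U s t)" for s t
      using V(4) by (simp add: F_def)
    then show ?thesis
      using abs_bilinear_le_cut_norm[OF U p _ q] P(2) Q(2) upd[OF z] by (simp add: p_def q_def)
  qed
  \<comment> \<open>The bound on slices is uniform in \<open>z\<close>, and integrating a constant
    over a probability space returns it.\<close>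
  have "\<bar>LINT x|N. F x\<bar> \<le> (LINT z|(\<Pi>\<^sub>M i\<in>I. unit_lborel). cut_norm U)"
    unfolding eq real_norm_def[symmetric]
    by (intro order_trans[OF integral_norm_bound integral_mono'])
      (use slice cut_norm_nonneg[OF U] in simp_all)
  then show ?thesis by (simp add: N.prob_space F_def)
qed

section \<open>Telescoping over the factors of a product\<close>

text \<open>A hybrid argument: the factors are switched from \<open>b\<close> to \<open>a\<close>
  one at a time, and each switch costs at most \<open>C\<close>. The bound by \<open>C\<close> is
  required for every set \<open>A\<close> of factors already switched, so no ordering of
  \<open>E\<close> has to be fixed.\<close>

lemma (in prob_space) abs_integral_prod_diff_le:
  fixes a b :: "'e \<Rightarrow> 'a \<Rightarrow> real"
  assumes E: "finite E"
    and a: "\<And>e. e \<in> E \<Longrightarrow> a e \<in> borel_measurable M"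
      "\<And>e x. e \<in> E \<Longrightarrow> x \<in> space M \<Longrightarrow> 0 \<le> a e x \<and> a e x \<le> 1"
    and b: "\<And>e. e \<in> E \<Longrightarrow> b e \<in> borel_measurable M"
      "\<And>e x. e \<in> E \<Longrightarrow> x \<in> space M \<Longrightarrow> 0 \<le> b e x \<and> b e x \<le> 1"
    and C: "\<And>e A. e \<in> E \<Longrightarrow>
      \<bar>LINT x|M. (\<Prod>d\<in>E - {e}. if d \<in> A then a d x else b d x) * (a e x - b e x)\<bar> \<le> C"
  shows "\<bar>(LINT x|M. (\<Prod>e\<in>E. a e x)) - (LINT x|M. (\<Prod>e\<in>E. b e x))\<bar> \<le> real (card E) * C"
proof -
  define m where "m A e = (if e \<in> A then a e else b e)" for A e
  have m: "m A e \<in> borel_measurable M" if "e \<in> E" for A e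
    using a(1)[OF that] b(1)[OF that] by (simp add: m_def)
  have m_bounds: "0 \<le> m A e x \<and> m A e x \<le> 1" if "e \<in> E" "x \<in> space M" for A e x
    using a(2)[OF that] b(2)[OF that] by (simp add: m_def)
  have int: "integrable M (\<lambda>x. \<Prod>e\<in>E. m A e x)" for A
  proof (rule integrable_const_bound[where B = 1])
    show "(\<lambda>x. \<Prod>e\<in>E. m A e x) \<in> borel_measurable M"
      by (intro borel_measurable_prod m)
    show "AE x in M. norm (\<Prod>d\<in>E. m A d x) \<le> 1"
      using m_bounds by (intro AE_I2) (simp add: abs_prod prod_le_1)
  qed
  \<comment> \<open>Induction on the set of switched factors; \<open>m {}\<close> is
    \<open>b\<close>, and \<open>m E\<close> agrees with \<open>a\<close> on
    \<open>E\<close>.\<close>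
  have step: "\<bar>(LINT x|M. (\<Prod>d\<in>E. m A d x)) - (LINT x|M. (\<Prod>d\<in>E. m {} d x))\<bar> \<le> real (card A) * C"
    if "A \<subseteq> E" for A
    using finite_subset[OF that E] that
  proof (induction A rule: finite_induct)
    case (insert e A)
    have e: "e \<in> E" using insert.prems by simp
    have "(LINT x|M. (\<Prod>d\<in>E. m (insert e A) d x)) - (LINT x|M. (\<Prod>d\<in>E. m A d x)) =
        (LINT x|M. (\<Prod>d\<in>E. m (insert e A) d x) - (\<Prod>d\<in>E. m A d x))"
      using Bochner_Integration.integral_diff[OF int[of "insert e A"] int[of A]] by simp
    also have "\<dots> = (LINT x|M. (\<Prod>d\<in>E - {e}. if d \<in> A then a d x else b d x) * (a e x - b e x))"
    proof (intro Bochner_Integration.integral_cong refl)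
      fix x
      define R where "R = (\<Prod>d\<in>E - {e}. if d \<in> A then a d x else b d x)"
      \<comment> \<open>Away from \<open>e\<close> the two hybrids coincide, so their products share
        the factor \<open>R\<close>.\<close>
      have "(\<Prod>d\<in>E - {e}. m (insert e A) d x) = R" "(\<Prod>d\<in>E - {e}. m A d x) = R"
        unfolding R_def by (rule prod.cong; simp add: m_def)+
      moreover have "m (insert e A) e x = a e x" "m A e x = b e x"
        using insert.hyps by (simp_all add: m_def)
      ultimately have "(\<Prod>d\<in>E. m (insert e A) d x) - (\<Prod>d\<in>E. m A d x) = R * (a e x - b e x)"
        by (simp only: prod.remove[OF E e] right_diff_distrib mult.commute)
      then show "(\<Prod>d\<in>E. m (insert e A) d x) - (\<Prod>d\<in>E. m A d x) =
          (\<Prod>d\<in>E - {e}. if d \<in> A then a d x else b d x) * (a e x - b e x)"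
        unfolding R_def .
    qed
    finally have "\<bar>(LINT x|M. (\<Prod>d\<in>E. m (insert e A) d x)) - (LINT x|M. (\<Prod>d\<in>E. m A d x))\<bar> \<le> C"
      using C[OF e, of A] by simp
    moreover have "\<bar>(LINT x|M. (\<Prod>d\<in>E. m A d x)) - (LINT x|M. (\<Prod>d\<in>E. m {} d x))\<bar> \<le> real (card A) * C"
      using insert.IH insert.prems by blast
    moreover have "real (card (insert e A)) * C = real (card A) * C + C"
      using insert.hyps by (simp add: distrib_right)
    ultimately show ?case by linarith
  qed simp
  have "(\<Prod>e\<in>E. m E e x) = (\<Prod>e\<in>E. a e x)" "(\<Prod>d\<in>E. m {} d x) = (\<Prod>e\<in>E. b e x)" for x
    by (simp_all add: m_def)
  with step[of E] show ?thesis by simp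
qed

section \<open>Edge weights as functions of the node positions\<close>

text \<open>The orientation chosen in \<open>edge_weight\<close> depends on the edge alone. One pair
  \<open>i\<close>, \<open>j\<close> therefore serves all \<open>W\<close> and \<open>x\<close>, and
  weights for different graphons can be subtracted at the same ordered pair.\<close>

lemma edge_weight_obtain:
  assumes "card e = 2"
  obtains i j where "e = {i, j}" "i \<noteq> j" "\<And>W x. edge_weight W x e = W (x i) (x j)"
proof -
  define p where "p = (SOME p. e = {fst p, snd p})"
  obtain i j where "e = {i, j}"
    using assms unfolding card_2_iff by blast
  then have "e = {fst (i, j), snd (i, j)}" by simp
  then have e: "e = {fst p, snd p}"
    unfolding p_def by (rule someI)
  show ?thesis
  proof (rule that[OF e])
    show "fst p \<noteq> snd p"
      using arg_cong[OF e, of card] assms by auto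
    show "edge_weight W x e = W (x (fst p)) (x (snd p))" for W x
      by (simp add: edge_weight_def p_def Let_def)
  qed
qed

lemma edge_weight_fun_upd:
  "card e = 2 \<Longrightarrow> v \<notin> e \<Longrightarrow> edge_weight W (x(v := y)) e = edge_weight W x e"
  by (rule edge_weight_obtain[of e]) auto

lemma edge_weight_bounds:
  assumes "card e = 2" "e \<subseteq> V" "graphon W" "x \<in> space (\<Pi>\<^sub>M i\<in>V. unit_lborel)"
  shows "0 \<le> edge_weight W x e \<and> edge_weight W x e \<le> 1"
proof -
  obtain i j where ij: "e = {i, j}" "\<And>W x. edge_weight W x e = W (x i) (x j)"
    using edge_weight_obtain[OF assms(1)] by metis
  have "x i \<in> {0..1}" "x j \<in> {0..1}"
    using ij(1) assms(2,4) by (auto simp: space_PiM PiE_iff)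
  then show ?thesis
    using graphon_bounds[OF assms(3)] by (simp add: ij(2))
qed

lemma edge_weight_measurable:
  assumes "card e = 2" "e \<subseteq> V" "graphon W"
  shows "(\<lambda>x. edge_weight W x e) \<in> borel_measurable (\<Pi>\<^sub>M i\<in>V. unit_lborel)"
proof -
  obtain i j where ij: "e = {i, j}" "\<And>W x. edge_weight W x e = W (x i) (x j)"
    using edge_weight_obtain[OF assms(1)] by metis
  have "(\<lambda>x. (x i, x j)) \<in> (\<Pi>\<^sub>M i\<in>V. unit_lborel) \<rightarrow>\<^sub>M unit_lborel \<Otimes>\<^sub>M unit_lborel"
    using ij(1) assms(2) by (intro measurable_Pair measurable_component_singleton) auto
  from measurable_compose[OF this unit_kernel_measurable[OF graphon_unit_kernel[OF assms(3)]]]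
  show ?thesis
    by (simp add: ij(2))
qed

section \<open>The counting lemma and its use for the mixed graphon\<close>

text \<open>The counting lemma for graphons, obtained by telescoping over the edges and bounding
  each difference by the single-edge estimate.\<close>

lemma abs_hom_density_diff_le:
  fixes F :: "'a graph"
  assumes F: "simple_graph F" and W: "graphon W" and W': "graphon W'"
  shows "\<bar>hom_density F W - hom_density F W'\<bar>
    \<le> real (num_edges F) * cut_norm (\<lambda>x y. W x y - W' x y)"
proof -
  define V where "V = nodes F"
  define E where "E = edges F"
  define N where "N = (\<Pi>\<^sub>M i\<in>V. unit_lborel)"
  have V: "finite V" and E: "\<And>e. e \<in> E \<Longrightarrow> card e = 2 \<and> e \<subseteq> V"
    using F by (auto simp: simple_graph_def V_def E_def)
  have finE: "finite E"
    using finite_subset[of E "Pow V"] V E by auto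
  interpret N: prob_space N
    unfolding N_def by (rule prob_space_PiM_unit_lborel)
  have "\<bar>(LINT x|N. (\<Prod>e\<in>E. edge_weight W x e)) - (LINT x|N. (\<Prod>e\<in>E. edge_weight W' x e))\<bar>
      \<le> real (card E) * cut_norm (\<lambda>x y. W x y - W' x y)"
  proof (rule N.abs_integral_prod_diff_le[OF finE])
    fix e :: "'a set" and A :: "'a set set"
    assume e: "e \<in> E"
    define K where "K d = (if d \<in> A then W else W')" for d
    have K: "graphon (K d)" for d
      using W W' by (simp add: K_def)
    obtain u v where uv: "e = {u, v}" "u \<noteq> v" "\<And>W x. edge_weight W x e = W (x u) (x v)"
      using E[OF e] edge_weight_obtain by metis
    \<comment> \<open>The remaining edges are split by whether they contain \<open>v\<close>: the
      product over \<open>D\<close> ignores the coordinate at \<open>v\<close>, the product over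
      \<open>D'\<close> the one at \<open>u\<close>.\<close>
    define D where "D = {d \<in> E - {e}. v \<notin> d}"
    define D' where "D' = {d \<in> E - {e}. v \<in> d}"
    have "finite D" "finite D'" "D \<inter> D' = {}" "E - {e} = D \<union> D'"
      using finE by (auto simp: D_def D'_def)
    then have split: "(\<Prod>d\<in>E - {e}. f d) = (\<Prod>d\<in>D. f d) * (\<Prod>d\<in>D'. f d)" for f :: "'a set \<Rightarrow> real"
      by (simp add: prod.union_disjoint)
    have DE: "card d = 2" "d \<subseteq> V" if "d \<in> D \<or> d \<in> D'" for d
      using that E by (auto simp: D_def D'_def)
    \<comment> \<open>An edge containing both \<open>u\<close> and \<open>v\<close> contains
      \<open>e\<close>; both have two elements, so it would be \<open>e\<close> itself, which is
      excluded from \<open>D'\<close>.\<close>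
    have u: "u \<notin> d" if "d \<in> D'" for d
    proof
      assume "u \<in> d"
      then have "e \<subseteq> d" "finite d" "card d = card e"
        using that DE E[OF e] by (auto simp: uv D'_def card_ge_0_finite)
      then show False
        using that card_subset_eq[of d e] by (simp add: D'_def)
    qed
    have "\<bar>LINT x|N. (\<Prod>d\<in>D. edge_weight (K d) x d) * ((\<Prod>d\<in>D'. edge_weight (K d) x d) *
        (W (x u) (x v) - W' (x u) (x v)))\<bar> \<le> cut_norm (\<lambda>x y. W x y - W' x y)"
      unfolding N_def
    proof (rule abs_integral_edge_le_cut_norm[OF unit_kernel_diff[OF W W'] V])
      show "u \<in> V" "v \<in> V" "u \<noteq> v"
        using E[OF e] uv by auto
      show "(\<Prod>d\<in>D. edge_weight (K d) (x(v := y)) d) = (\<Prod>d\<in>D. edge_weight (K d) x d)" for x y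
        by (rule prod.cong) (auto simp: D_def E edge_weight_fun_upd)
      show "(\<Prod>d\<in>D'. edge_weight (K d) (x(u := y)) d) = (\<Prod>d\<in>D'. edge_weight (K d) x d)" for x y
        by (rule prod.cong) (auto simp: DE u edge_weight_fun_upd)
    qed (simp_all add: DE K borel_measurable_prod edge_weight_measurable prod_nonneg prod_le_1
        edge_weight_bounds[of _ V])
    also have "(\<lambda>x. (\<Prod>d\<in>D. edge_weight (K d) x d) * ((\<Prod>d\<in>D'. edge_weight (K d) x d) *
          (W (x u) (x v) - W' (x u) (x v)))) =
        (\<lambda>x. (\<Prod>d\<in>E - {e}. if d \<in> A then edge_weight W x d else edge_weight W' x d) *
          (edge_weight W x e - edge_weight W' x e))"
      by (simp add: split uv(3) K_def if_distrib[of "\<lambda>W. edge_weight W _ _"] mult.assoc cong: if_cong)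
    finally show "\<bar>LINT x|N. (\<Prod>d\<in>E - {e}. if d \<in> A then edge_weight W x d else edge_weight W' x d) *
          (edge_weight W x e - edge_weight W' x e)\<bar> \<le> cut_norm (\<lambda>x y. W x y - W' x y)" .
  qed (use E W W' in \<open>auto simp: N_def edge_weight_measurable edge_weight_bounds[of _ V]\<close>)
  then show ?thesis
    by (simp add: hom_density_def N_def V_def E_def unit_lborel_def)
qed

lemma discriminative_motif_simple:
  "F \<in> discriminative_motifs decides C \<Longrightarrow> simple_graph F"
  by (auto simp: discriminative_motifs_def discriminative_motif_def deciding_subgraph_def subgraph_def)

text \<open>Lets both comparisons with the mixed graphon be measured by the same kernel
  \<open>U\<close>, with the sign of the scalar absorbed by \<open>\<bar>c\<bar>\<close>.\<close>

lemma abs_hom_density_diff_scaled_le: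
  assumes "simple_graph F" "graphon W" "graphon W'" "unit_kernel U"
    and "\<And>x y. W x y - W' x y = c * U x y"
  shows "\<bar>hom_density F W - hom_density F W'\<bar> \<le> \<bar>c\<bar> * real (num_edges F) * cut_norm U"
proof -
  have "\<bar>hom_density F W - hom_density F W'\<bar> \<le> real (num_edges F) * cut_norm (\<lambda>x y. c * U x y)"
    using abs_hom_density_diff_le[OF assms(1-3)] by (simp add: assms(5))
  also have "\<dots> \<le> real (num_edges F) * (\<bar>c\<bar> * cut_norm U)"
    by (intro mult_left_mono cut_norm_cmult_le assms(4)) simp
  finally show ?thesis
    by (simp add: mult_ac)
qed

theorem theorem4p2:
  fixes \<G> \<H> :: "'a graph set"
    and decides :: "'a graph \<Rightarrow> 'a graph \<Rightarrow> 'a graph set \<Rightarrow> bool"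
    and W :: "'a graph set \<Rightarrow> real \<Rightarrow> real \<Rightarrow> real"
    and l :: real
  assumes "\<forall>G\<in>\<G>. simple_graph G"
    and "\<forall>H\<in>\<H>. simple_graph H"
    and "graphon (W \<G>)"
    and "graphon (W \<H>)"
    and "\<forall>G\<in>\<G>. \<exists>F. discriminative_motif decides \<G> G F"
    and "\<forall>H\<in>\<H>. \<exists>F. discriminative_motif decides \<H> H F"
    and "finite_up_to_iso (discriminative_motifs decides \<G>)"
    and "finite_up_to_iso (discriminative_motifs decides \<H>)"
    and "0 \<le> l" and "l \<le> 1"
  shows "\<forall>F\<^sub>G \<in> discriminative_motifs decides \<G>. \<forall>F\<^sub>H \<in> discriminative_motifs decides \<H>.
      \<bar>hom_density F\<^sub>G (mix_graphon l (W \<G>) (W \<H>)) - hom_density F\<^sub>G (W \<G>)\<bar>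
        \<le> (1 - l) * real (num_edges F\<^sub>G) * cut_norm (\<lambda>x y. W \<H> x y - W \<G> x y)
    \<and> \<bar>hom_density F\<^sub>H (mix_graphon l (W \<G>) (W \<H>)) - hom_density F\<^sub>H (W \<H>)\<bar>
        \<le> l * real (num_edges F\<^sub>H) * cut_norm (\<lambda>x y. W \<H> x y - W \<G> x y)"
proof (intro ballI conjI)
  have mix: "graphon (mix_graphon l (W \<G>) (W \<H>))"
    using graphon_mix_graphon assms(3,4,9,10) by blast
  have U: "unit_kernel (\<lambda>x y. W \<H> x y - W \<G> x y)"
    by (rule unit_kernel_diff[OF assms(4,3)])
  fix F\<^sub>G F\<^sub>H
  assume FG: "F\<^sub>G \<in> discriminative_motifs decides \<G>"
    and FH: "F\<^sub>H \<in> discriminative_motifs decides \<H>"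
  show "\<bar>hom_density F\<^sub>G (mix_graphon l (W \<G>) (W \<H>)) - hom_density F\<^sub>G (W \<G>)\<bar>
      \<le> (1 - l) * real (num_edges F\<^sub>G) * cut_norm (\<lambda>x y. W \<H> x y - W \<G> x y)"
    \<comment> \<open>The mixture minus \<open>W \<G>\<close> equals \<open>1 - l\<close> times
      \<open>W \<H> - W \<G>\<close>.\<close>
    using abs_hom_density_diff_scaled_le[OF discriminative_motif_simple[OF FG] mix assms(3) U, of "1 - l"]
      assms(10) by (simp add: mix_graphon_def algebra_simps)
  show "\<bar>hom_density F\<^sub>H (mix_graphon l (W \<G>) (W \<H>)) - hom_density F\<^sub>H (W \<H>)\<bar>
      \<le> l * real (num_edges F\<^sub>H) * cut_norm (\<lambda>x y. W \<H> x y - W \<G> x y)"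
    \<comment> \<open>The mixture minus \<open>W \<H>\<close> equals \<open>- l\<close> times
      \<open>W \<H> - W \<G>\<close>, and the absolute value of \<open>- l\<close> is
      \<open>l\<close>.\<close>
    using abs_hom_density_diff_scaled_le[OF discriminative_motif_simple[OF FH] mix assms(4) U, of "- l"]
      assms(9) by (simp add: mix_graphon_def algebra_simps)
qed

end
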